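(* Let $\beta\in[0,1]$ and $f\in\mathcal{A}_\beta$. Then: (i) the function $z\mapsto\displaystyle\int_0^z\frac{f(t)-f(0)}{t}\,dt=\int_0^z\frac{f(t)}{t}\,dt$ belongs to $\mathcal{A}_\beta$; (ii) the function $z\mapsto\displaystyle\frac{2}{z}\int_0^z f(t)\,dt$ belongs to $\mathcal{A}_\beta$.
   Context: $\mathbb{D}=\{z\in\mathbb{C}:|z|<1\}$. $\mathcal{A}$ is the class of functions $f$ holomorphic in $\mathbb{D}$ with $f(0)=0$ and $f'(0)=1$. For $\beta\in[0,1]$, $$\mathcal{A}_\beta=\left\{f\in\mathcal{A}:\operatorname{Re}\left(\beta\frac{f(z)}{z}+(1-\beta)f'(z)\right)>0 \text{ for all } z\in\mathbb{D}\right\},$$ where $f(z)/z$ is given the value $1$ at $z=0$. Removable singularities at $0$ are removed. *)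

theory Defs
  imports "HOL-Complex_Analysis.Complex_Analysis"
begin

abbreviation unit_disc :: "complex set" where
  "unit_disc \<equiv> ball 0 1"

text \<open>Functions on the unit disc are represented by total functions on the complex numbers; only
  their values on the disc matter for membership in the following classes.\<close>

definition normalized_class :: "(complex \<Rightarrow> complex) set" where
  "normalized_class = {f. f holomorphic_on unit_disc \<and> f 0 = 0 \<and> deriv f 0 = 1}"

definition class_A :: "real \<Rightarrow> (complex \<Rightarrow> complex) set" where
  "class_A \<beta> = {f \<in> normalized_class. \<forall>z\<in>unit_disc.
     Re (of_real \<beta> * (if z = 0 then 1 else f z / z) + (1 - of_real \<beta>) * deriv f z) > 0}"

text \<open>The integral from \<open>0\<close> to \<open>z\<close> is taken along the straight segment; for integrands
  holomorphic in the disc this is the path-independent integral.\<close>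

definition integral_from_0 :: "(complex \<Rightarrow> complex) \<Rightarrow> complex \<Rightarrow> complex" where
  "integral_from_0 g z = contour_integral (linepath 0 z) g"

end

theory Submission
  imports Defs
begin

text \<open>Write \<open>p\<^sub>f(z) = \<beta> f(z)/z + (1 - \<beta>) f'(z)\<close>; membership of a normalised \<open>f\<close> in the class means
  \<open>Re p\<^sub>f > 0\<close>. Both integral operators are Bernardi operators
  \<open>g(z) = n z\<^sup>1\<^sup>-\<^sup>n \<integral> t\<^sup>n\<^sup>-\<^sup>2 f(t) dt\<close> (from \<open>0\<close> to \<open>z\<close>), with \<open>n = 1\<close> in (i) and \<open>n = 2\<close> in (ii).
  They are characterised by \<open>g(0) = 0\<close> and the differential equation
  \<open>n f = (n - 1) g + z g'\<close>.

  The functional \<open>p\<close> commutes with the operator that sends \<open>g\<close> to \<open>f\<close>: dividing the equation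
  by \<open>z\<close>, respectively differentiating it, and combining the two gives
  \<open>n p\<^sub>f = n p\<^sub>g + z p\<^sub>g'\<close>, that is, \<open>(z\<^sup>n p\<^sub>g)' = n z\<^sup>n\<^sup>-\<^sup>1 p\<^sub>f\<close>. Along a radius this says that
  \<open>t\<^sup>n Re p\<^sub>g(t z)\<close> has derivative \<open>n t\<^sup>n\<^sup>-\<^sup>1 Re p\<^sub>f(t z) > 0\<close> for \<open>t > 0\<close>. As it vanishes at \<open>t = 0\<close>,
  its value \<open>Re p\<^sub>g(z)\<close> at \<open>t = 1\<close> is positive. Lemma \<open>Re_pos_of_radial_derivative\<close> is this
  monotonicity argument, and lemma \<open>bernardi_class_A\<close> is the commutation.\<close>

text \<open>The hypothesis is positivity of \<open>Re (z\<^sup>n q)'/z\<^sup>n\<^sup>-\<^sup>1\<close>, so \<open>t\<^sup>n Re q(t z)\<close> increases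
  strictly from \<open>0\<close> at \<open>t = 0\<close>.\<close>
lemma Re_pos_of_radial_derivative:
  fixes q :: "complex \<Rightarrow> complex" and n :: nat
  assumes q: "q holomorphic_on unit_disc" and n: "n \<ge> 1"
    and pos: "\<And>z. z \<in> unit_disc \<Longrightarrow> Re (of_nat n * q z + z * deriv q z) > 0"
    and z: "z \<in> unit_disc"
  shows "Re (q z) > 0"
proof -
  have in_disc: "of_real t * z \<in> unit_disc" if "0 \<le> t" "t \<le> 1" for t
    using that z mult_left_le_one_le[of "norm z" t] by (simp add: norm_mult)
  define u where "u w = w ^ n * q (w * z)" for w
  define v where "v t = Re (u (of_real t))" for t
  have der: "(v has_real_derivative
      t ^ (n - 1) * Re (of_nat n * q (of_real t * z) + of_real t * z * deriv q (of_real t * z))) (at t)"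
    if "0 \<le> t" "t \<le> 1" for t
  proof -
    have dq: "(q has_field_derivative deriv q (of_real t * z)) (at (of_real t * z))"
      by (intro holomorphic_derivI[OF q] in_disc that) simp
    have dqz: "((\<lambda>w. q (w * z)) has_field_derivative deriv q (of_real t * z) * z) (at (of_real t))"
      by (rule DERIV_chain'[where f = "\<lambda>w. w * z" and g = q, OF _ dq])
        (auto intro!: derivative_eq_intros)
    have "(u has_field_derivative (of_nat n * of_real t ^ (n - 1)) * q (of_real t * z)
            + (deriv q (of_real t * z) * z) * of_real t ^ n) (at (of_real t))"
      unfolding u_def by (rule derivative_eq_intros dqz refl | simp)+
    also have "(of_nat n * of_real t ^ (n - 1)) * q (of_real t * z)
            + (deriv q (of_real t * z) * z) * of_real t ^ n
        = of_real (t ^ (n - 1)) * (of_nat n * q (of_real t * z) + of_real t * z * deriv q (of_real t * z))"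
      using n by (cases n) (auto simp: algebra_simps)
    finally have "((\<lambda>t. u (of_real t)) has_vector_derivative
        of_real (t ^ (n - 1)) * (of_nat n * q (of_real t * z) + of_real t * z * deriv q (of_real t * z))) (at t)"
      by (rule has_vector_derivative_real_field)
    from bounded_linear.has_vector_derivative[OF bounded_linear_Re this]
    show ?thesis
      unfolding v_def has_real_derivative_iff_has_vector_derivative
      by (simp only: Re_complex_of_real times_complex.sel Im_complex_of_real) simp
  qed
  have "v 0 < v 1"
  proof (rule DERIV_pos_imp_increasing_open[where f = v])
    show "\<exists>y. DERIV v t :> y \<and> y > 0" if "0 < t" "t < 1" for t
    proof (intro exI conjI)
      show "t ^ (n - 1) * Re (of_nat n * q (of_real t * z) + of_real t * z * deriv q (of_real t * z)) > 0"
        using that by (intro mult_pos_pos pos in_disc) auto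
    qed (rule der, use that in auto)
    show "continuous_on {0..1} v"
      by (intro continuous_at_imp_continuous_on ballI DERIV_isCont[OF der]) auto
  qed simp
  then show ?thesis
    using n by (simp add: v_def u_def zero_power)
qed

text \<open>Makes \<open>g(z)/z\<close> available as a holomorphic function at the origin, with the same case
  distinction as in the definition of the class.\<close>
lemma normalized_quotient_holomorphic:
  assumes "g holomorphic_on unit_disc" "g 0 = 0" "deriv g 0 = 1"
  shows "(\<lambda>z. if z = 0 then 1 else g z / z) holomorphic_on unit_disc"
  by (rule pole_theorem_open_0[OF assms(1), where a = 0]) (use assms in auto)

text \<open>The differential equation \<open>n f = (n - 1) g + z g'\<close> transfers both the
  normalisation and the positivity of the real part. Differentiating it gives
  \<open>n f' = n g' + z g''\<close>, which at \<open>0\<close> reads \<open>g'(0) = f'(0) = 1\<close>; dividing it by \<open>z\<close> gives the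
  same relation between \<open>f/z\<close> and \<open>K = g/z\<close>, namely \<open>n f/z = n K + z K'\<close>. Hence
  \<open>q = \<beta> K + (1 - \<beta>) g'\<close> satisfies \<open>Re (n q + z q') > 0\<close>.\<close>
lemma bernardi_class_A:
  fixes n :: nat
  assumes f: "f \<in> class_A \<beta>" and n: "n \<ge> 1"
    and g: "g holomorphic_on unit_disc" and g0: "g 0 = 0"
    and ode: "\<And>z. z \<in> unit_disc \<Longrightarrow> of_nat n * f z = (of_nat n - 1) * g z + z * deriv g z"
  shows "g \<in> class_A \<beta>"
proof -
  have fhol: "f holomorphic_on unit_disc" and f'0: "deriv f 0 = 1"
    and fpos: "\<And>z. z \<in> unit_disc \<Longrightarrow>
      Re (of_real \<beta> * (if z = 0 then 1 else f z / z) + (1 - of_real \<beta>) * deriv f z) > 0"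
    using f by (auto simp: class_A_def normalized_class_def)
  have g'hol: "deriv g holomorphic_on unit_disc"
    by (intro holomorphic_deriv g) auto
  have ode': "of_nat n * deriv f z = of_nat n * deriv g z + z * deriv (deriv g) z"
    if z: "z \<in> unit_disc" for z
  proof -
    have "((\<lambda>z. of_nat n * f z) has_field_derivative of_nat n * deriv f z) (at z)"
      by (intro DERIV_cmult holomorphic_derivI[OF fhol _ z]) simp
    moreover have "((\<lambda>z. (of_nat n - 1) * g z + z * deriv g z) has_field_derivative
        (of_nat n - 1) * deriv g z + (1 * deriv g z + deriv (deriv g) z * z)) (at z)"
      by (intro DERIV_add DERIV_cmult DERIV_mult DERIV_ident
          holomorphic_derivI[OF g _ z] holomorphic_derivI[OF g'hol _ z]) simp_all
    then have "((\<lambda>z. of_nat n * f z) has_field_derivative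
        (of_nat n - 1) * deriv g z + (1 * deriv g z + deriv (deriv g) z * z)) (at z)"
      by (rule has_field_derivative_transform_within_open[OF _ open_ball z]) (simp add: ode)
    ultimately show ?thesis
      by (metis (no_types, lifting) DERIV_unique[symmetric] add.assoc diff_add_cancel distrib_right
          mult.commute)
  qed
  have g'0: "deriv g 0 = 1"
    using ode'[of 0] n f'0 by auto
  define K where "K z = (if z = 0 then 1 else g z / z)" for z
  have Khol: "K holomorphic_on unit_disc"
    using normalized_quotient_holomorphic[OF g g0 g'0] by (simp add: K_def[abs_def])
  have g_eq: "g z = z * K z" for z
    using g0 by (simp add: K_def)
  have g'_eq: "deriv g z = K z + z * deriv K z" if z: "z \<in> unit_disc" for z
  proof -
    have "(g has_field_derivative 1 * K z + deriv K z * z) (at z)"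
      unfolding g_eq[abs_def]
      by (intro DERIV_mult DERIV_ident holomorphic_derivI[OF Khol _ z]) simp
    then show ?thesis
      by (simp add: DERIV_imp_deriv mult.commute)
  qed
  have quot_eq: "of_nat n * (if z = 0 then 1 else f z / z) = of_nat n * K z + z * deriv K z"
    if z: "z \<in> unit_disc" for z
  proof (cases "z = 0")
    case False
    have "of_nat n * f z = z * (of_nat n * K z + z * deriv K z)"
      using ode[OF z] g'_eq[OF z] g_eq[of z] by (simp add: algebra_simps)
    then show ?thesis
      using False by (simp add: field_simps)
  qed (simp add: K_def)
  define q where "q z = of_real \<beta> * K z + (1 - of_real \<beta>) * deriv g z" for z
  have qhol: "q holomorphic_on unit_disc"
    unfolding q_def by (intro holomorphic_intros Khol g'hol)
  have "Re (q z) > 0" if "z \<in> unit_disc" for z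
  proof (rule Re_pos_of_radial_derivative[OF qhol n _ that])
    fix z :: complex
    assume z: "z \<in> unit_disc"
    have "(q has_field_derivative of_real \<beta> * deriv K z + (1 - of_real \<beta>) * deriv (deriv g) z) (at z)"
      unfolding q_def[abs_def]
      by (intro DERIV_add DERIV_cmult holomorphic_derivI[OF Khol _ z]
          holomorphic_derivI[OF g'hol _ z]) simp_all
    then have q': "deriv q z = of_real \<beta> * deriv K z + (1 - of_real \<beta>) * deriv (deriv g) z"
      by (rule DERIV_imp_deriv)
    have "of_nat n * q z + z * deriv q z
        = of_real \<beta> * (of_nat n * K z + z * deriv K z)
          + (1 - of_real \<beta>) * (of_nat n * deriv g z + z * deriv (deriv g) z)"
      unfolding q' q_def by (simp add: algebra_simps)
    also have "\<dots> = of_real (real n) *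
        (of_real \<beta> * (if z = 0 then 1 else f z / z) + (1 - of_real \<beta>) * deriv f z)"
      unfolding quot_eq[OF z, symmetric] ode'[OF z, symmetric] by (simp add: algebra_simps)
    finally have "Re (of_nat n * q z + z * deriv q z) = real n *
        Re (of_real \<beta> * (if z = 0 then 1 else f z / z) + (1 - of_real \<beta>) * deriv f z)"
      by (simp only: Re_complex_of_real times_complex.sel Im_complex_of_real)
    then show "Re (of_nat n * q z + z * deriv q z) > 0"
      using fpos[OF z] n by simp
  qed
  then show ?thesis
    using g g0 g'0 by (auto simp: class_A_def normalized_class_def q_def K_def)
qed

lemma integral_from_0_has_field_derivative:
  assumes h: "h holomorphic_on unit_disc" and z: "z \<in> unit_disc"
  shows "(integral_from_0 h has_field_derivative h z) (at z)"
proof -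
  obtain H where H: "\<And>x. x \<in> unit_disc \<Longrightarrow> (H has_field_derivative h x) (at x within unit_disc)"
    using holomorphic_convex_primitive'[OF convex_ball open_ball h] by blast
  have eq: "integral_from_0 h w = H w - H 0" if w: "w \<in> unit_disc" for w
  proof -
    have "closed_segment 0 w \<subseteq> unit_disc"
      using w by (intro closed_segment_subset) auto
    then have "(h has_contour_integral (H (pathfinish (linepath 0 w)) - H (pathstart (linepath 0 w))))
        (linepath 0 w)"
      by (intro contour_integral_primitive[OF H]) auto
    then show ?thesis
      unfolding integral_from_0_def by (simp add: contour_integral_unique)
  qed
  have "(H has_field_derivative h z) (at z)"
    using H[OF z] at_within_open[OF z open_ball] by simp
  then have "((\<lambda>w. H w - H 0) has_field_derivative h z) (at z)"
    by (auto intro!: derivative_eq_intros)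
  then show ?thesis
    by (rule has_field_derivative_transform_within_open[OF _ open_ball z]) (simp add: eq)
qed

lemma integral_from_0_holomorphic:
  assumes "h holomorphic_on unit_disc"
  shows "integral_from_0 h holomorphic_on unit_disc"
  using integral_from_0_has_field_derivative[OF assms]
  by (subst holomorphic_on_open) blast+

lemma integral_from_0_at_0 [simp]: "integral_from_0 h 0 = 0"
  by (simp add: integral_from_0_def)

lemma remove_sings_eq_holomorphic_extension:
  assumes "open S" "K holomorphic_on S" "z \<in> S"
    and eq: "\<And>w. w \<in> S \<Longrightarrow> w \<noteq> a \<Longrightarrow> F w = K w"
  shows "remove_sings F z = K z"
proof -
  have K: "K analytic_on {z}"
    using assms by (meson analytic_at)
  have "eventually (\<lambda>w. w \<in> S \<and> w \<noteq> a) (at z)"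
    using eventually_at_in_open'[OF assms(1,3)] eventually_neq_at_within by (rule eventually_conj)
  then have "remove_sings F z = remove_sings K z"
    by (intro remove_sings_cong) (auto elim!: eventually_mono simp: eq)
  with K show ?thesis
    by simp
qed

text \<open>This is the case \<open>n = 1\<close> of the Bernardi equation, \<open>f = z g'\<close>.\<close>
lemma integral_quotient_class_A:
  assumes f: "f \<in> class_A \<beta>"
  shows "integral_from_0 (remove_sings (\<lambda>t. f t / t)) \<in> class_A \<beta>"
proof -
  have fhol: "f holomorphic_on unit_disc" and f0: "f 0 = 0" and f'0: "deriv f 0 = 1"
    using f by (auto simp: class_A_def normalized_class_def)
  define h where "h = remove_sings (\<lambda>t. f t / t)"
  have quot: "(\<lambda>z. if z = 0 then 1 else f z / z) holomorphic_on unit_disc"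
    by (rule normalized_quotient_holomorphic[OF fhol f0 f'0])
  have h_eq: "h z = (if z = 0 then 1 else f z / z)" if "z \<in> unit_disc" for z
    unfolding h_def
    by (rule remove_sings_eq_holomorphic_extension[OF open_ball quot that, where a = 0]) simp
  have hhol: "h holomorphic_on unit_disc"
    using quot by (rule holomorphic_transform) (simp add: h_eq)
  have "integral_from_0 h \<in> class_A \<beta>"
  proof (rule bernardi_class_A[OF f order_refl])
    show "of_nat 1 * f z = (of_nat 1 - 1) * integral_from_0 h z + z * deriv (integral_from_0 h) z"
      if z: "z \<in> unit_disc" for z
      using DERIV_imp_deriv[OF integral_from_0_has_field_derivative[OF hhol z]] h_eq[OF z] f0 by simp
  qed (simp_all add: integral_from_0_holomorphic hhol)
  then show ?thesis
    by (simp add: h_def)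
qed

text \<open>This is the case \<open>n = 2\<close>: differentiating \<open>z g = 2 \<integral> f\<close> gives \<open>2 f = g + z g'\<close>.\<close>
lemma integral_mean_class_A:
  assumes f: "f \<in> class_A \<beta>"
  shows "remove_sings (\<lambda>z. 2 / z * integral_from_0 f z) \<in> class_A \<beta>"
proof -
  have fhol: "f holomorphic_on unit_disc" and f0: "f 0 = 0"
    using f by (auto simp: class_A_def normalized_class_def)
  define g where "g = remove_sings (\<lambda>z. 2 / z * integral_from_0 f z)"
  define G where "G z = (if z = 0 then 0 else 2 / z * integral_from_0 f z)" for z
  have dI: "((\<lambda>z. 2 * integral_from_0 f z) has_field_derivative 2 * f z) (at z)"
    if "z \<in> unit_disc" for z
    by (intro DERIV_cmult integral_from_0_has_field_derivative fhol that)
  have Ghol: "G holomorphic_on unit_disc"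
  proof (rule pole_theorem_open_0[where a = 0])
    show "(\<lambda>z. 2 * integral_from_0 f z) holomorphic_on unit_disc"
      by (intro holomorphic_intros integral_from_0_holomorphic fhol)
    \<comment> \<open>The value of the extension at the origin is \<open>2 f(0) = 0\<close>.\<close>
    show "G 0 = deriv (\<lambda>z. 2 * integral_from_0 f z) 0"
      using DERIV_imp_deriv[OF dI[of 0]] f0 by (simp add: G_def)
  qed (auto simp: G_def)
  have g_eq: "g z = G z" if "z \<in> unit_disc" for z
    unfolding g_def
    by (rule remove_sings_eq_holomorphic_extension[OF open_ball Ghol that, where a = 0])
      (simp add: G_def)
  have ghol: "g holomorphic_on unit_disc"
    using Ghol by (rule holomorphic_transform) (simp add: g_eq)
  have "g \<in> class_A \<beta>"
  proof (rule bernardi_class_A[OF f _ ghol])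
    show "of_nat 2 * f z = (of_nat 2 - 1) * g z + z * deriv g z" if z: "z \<in> unit_disc" for z
    proof -
      have "((\<lambda>w. w * g w) has_field_derivative 1 * g z + deriv g z * z) (at z)"
        by (intro DERIV_mult DERIV_ident holomorphic_derivI[OF ghol _ z]) simp
      then have "((\<lambda>w. 2 * integral_from_0 f w) has_field_derivative 1 * g z + deriv g z * z) (at z)"
        by (rule has_field_derivative_transform_within_open[OF _ open_ball z])
          (simp add: g_eq G_def)
      from DERIV_unique[OF dI[OF z] this] show ?thesis
        by (simp add: mult.commute)
    qed
  qed (simp_all add: g_eq G_def)
  then show ?thesis
    by (simp add: g_def)
qed

theorem corollary2p8:
  fixes \<beta> :: real and f :: "complex \<Rightarrow> complex"
  assumes "\<beta> \<in> {0..1}" and "f \<in> class_A \<beta>"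
  shows "((\<forall>z\<in>unit_disc. integral_from_0 (remove_sings (\<lambda>t. (f t - f 0) / t)) z
                       = integral_from_0 (remove_sings (\<lambda>t. f t / t)) z)
          \<and> (\<lambda>z. integral_from_0 (remove_sings (\<lambda>t. (f t - f 0) / t)) z) \<in> class_A \<beta>)
       \<and> remove_sings (\<lambda>z. 2 / z * integral_from_0 f z) \<in> class_A \<beta>"
proof -
  have "f 0 = 0"
    using assms(2) by (simp add: class_A_def normalized_class_def)
  then show ?thesis
    using integral_quotient_class_A[OF assms(2)] integral_mean_class_A[OF assms(2)] by simp
qed

end
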